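(* Let $\mathfrak{O}^{(0)}=\mathfrak{O}_s\cup\mathfrak{O}_r^{(0)}$ be a finite ontology and $\alpha$ an axiom such that $\mathfrak{O}^{(0)}\models\alpha$ and $\mathfrak{O}_s\not\models\alpha$, and let $n=|\mathfrak{O}_r^{(0)}|$. Consider the iterative gentle repair algorithm: as long as $\mathfrak{O}_s\cup\mathfrak{O}_r^{(i)}\models\alpha$, compute all justifications $J_1,\dots,J_k$ for $\alpha$ in $\mathfrak{O}_s\cup\mathfrak{O}_r^{(i)}$ and a minimal hitting set $H$ of them, and obtain $\mathfrak{O}_r^{(i+1)}$ from $\mathfrak{O}_r^{(i)}$ by replacing each $\beta\in H$ by an axiom $\gamma_\beta$ that is weaker than $\beta$ and satisfies $\mathfrak{O}_s\cup(J_j\setminus\{\beta\})\cup\{\gamma_\beta\}\not\models\alpha$ for every $j$ with $\beta\in J_j$. Then every run of this algorithm on $\mathfrak{O}^{(0)}$ and $\alpha$ stops after a number of iterations that is at most exponential in $n$, and its output $\mathfrak{O}_r^{(m)}$ (at termination) is a repair of $\mathfrak{O}^{(0)}$ w.r.t. $\alpha$.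
   Context: Fix a logic with a model-theoretic semantics: a class of interpretations and a satisfaction relation between interpretations and axioms; an ontology is a finite set of axioms, an interpretation is a model of it if it satisfies all its axioms, $\mathfrak{O}\models\alpha$ iff every model of $\mathfrak{O}$ satisfies $\alpha$, and $\mathit{Con}(\mathfrak{O})=\{\alpha\mid\mathfrak{O}\models\alpha\}$. A tautology is an axiom $\alpha$ with $\emptyset\models\alpha$; it is assumed that tautologies exist (e.g. the description logic $\mathcal{EL}$, where $C\sqsubseteq\top$ is a tautology). An ontology is split as $\mathfrak{O}=\mathfrak{O}_s\cup\mathfrak{O}_r$ into a static part $\mathfrak{O}_s$ and a refutable part $\mathfrak{O}_r$. A justification for $\alpha$ in $\mathfrak{O}_s\cup\mathfrak{O}_r$ is a subset $J\subseteq\mathfrak{O}_r$, minimal w.r.t. inclusion, with $\mathfrak{O}_s\cup J\models\alpha$. A minimal hitting set of $J_1,\dots,J_k$ is an inclusion-minimal set intersecting every $J_j$. An axiom $\gamma$ is weaker than $\beta$ if $\mathit{Con}(\{\gamma\})\subsetneq\mathit{Con}(\{\beta\})$. Given $\mathfrak{O}=\mathfrak{O}_s\cup\mathfrak{O}_r$ with $\mathfrak{O}_s\not\models\alpha$, an ontology $\mathfrak{O}'$ is a repair of $\mathfrak{O}$ w.r.t. $\alpha$ if $\mathit{Con}(\mathfrak{O}_s\cup\mathfrak{O}')\subseteq\mathit{Con}(\mathfrak{O})$ and $\alpha\notin\mathit{Con}(\mathfrak{O}_s\cup\mathfrak{O}')$. *)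

theory Defs
  imports Main "HOL-Library.Extended_Nat"
begin

text \<open>
  A logic is given by a satisfaction relation \<open>sat\<close> between interpretations (the type \<open>'i\<close>) and
  axioms (the type \<open>'a\<close>). The semantic notions make sense for arbitrary sets of axioms; finiteness
  of ontologies is required explicitly where it is needed.
\<close>

definition is_model :: "('i \<Rightarrow> 'a \<Rightarrow> bool) \<Rightarrow> 'i \<Rightarrow> 'a set \<Rightarrow> bool" where
  "is_model sat I Ont \<longleftrightarrow> (\<forall>\<beta>\<in>Ont. sat I \<beta>)"

definition entails :: "('i \<Rightarrow> 'a \<Rightarrow> bool) \<Rightarrow> 'a set \<Rightarrow> 'a \<Rightarrow> bool" where
  "entails sat Ont \<alpha> \<longleftrightarrow> (\<forall>I. is_model sat I Ont \<longrightarrow> sat I \<alpha>)"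

definition Con :: "('i \<Rightarrow> 'a \<Rightarrow> bool) \<Rightarrow> 'a set \<Rightarrow> 'a set" where
  "Con sat Ont = {\<alpha>. entails sat Ont \<alpha>}"

definition tautology :: "('i \<Rightarrow> 'a \<Rightarrow> bool) \<Rightarrow> 'a \<Rightarrow> bool" where
  "tautology sat \<tau> \<longleftrightarrow> entails sat {} \<tau>"

definition weaker :: "('i \<Rightarrow> 'a \<Rightarrow> bool) \<Rightarrow> 'a \<Rightarrow> 'a \<Rightarrow> bool" where
  "weaker sat \<gamma> \<beta> \<longleftrightarrow> Con sat {\<gamma>} \<subset> Con sat {\<beta>}"

definition justification ::
  "('i \<Rightarrow> 'a \<Rightarrow> bool) \<Rightarrow> 'a set \<Rightarrow> 'a set \<Rightarrow> 'a \<Rightarrow> 'a set \<Rightarrow> bool" where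
  "justification sat Os Or \<alpha> J \<longleftrightarrow>
     J \<subseteq> Or \<and> entails sat (Os \<union> J) \<alpha> \<and> (\<forall>J'. J' \<subset> J \<longrightarrow> \<not> entails sat (Os \<union> J') \<alpha>)"

definition hitting_set :: "'a set set \<Rightarrow> 'a set \<Rightarrow> bool" where
  "hitting_set \<J> H \<longleftrightarrow> (\<forall>J\<in>\<J>. H \<inter> J \<noteq> {})"

definition minimal_hitting_set :: "'a set set \<Rightarrow> 'a set \<Rightarrow> bool" where
  "minimal_hitting_set \<J> H \<longleftrightarrow> hitting_set \<J> H \<and> (\<forall>H'. H' \<subset> H \<longrightarrow> \<not> hitting_set \<J> H')"

text \<open>\<open>repair sat Os Or \<alpha> O'\<close>: the ontology \<open>O'\<close> is a repair of \<open>Os \<union> Or\<close> w.r.t. \<open>\<alpha>\<close>.\<close>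

definition repair ::
  "('i \<Rightarrow> 'a \<Rightarrow> bool) \<Rightarrow> 'a set \<Rightarrow> 'a set \<Rightarrow> 'a \<Rightarrow> 'a set \<Rightarrow> bool" where
  "repair sat Os Or \<alpha> O' \<longleftrightarrow>
     finite O' \<and> Con sat (Os \<union> O') \<subseteq> Con sat (Os \<union> Or) \<and> \<alpha> \<notin> Con sat (Os \<union> O')"

text \<open>
  One iteration of the loop, turning the refutable part \<open>Or\<close> into \<open>Or'\<close>. The first conjunct is the
  loop guard; the hitting set \<open>H\<close> and the replacements \<open>g \<beta>\<close> are chosen nondeterministically.
\<close>

definition gentle_step ::
  "('i \<Rightarrow> 'a \<Rightarrow> bool) \<Rightarrow> 'a set \<Rightarrow> 'a \<Rightarrow> 'a set \<Rightarrow> 'a set \<Rightarrow> bool" where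
  "gentle_step sat Os \<alpha> Or Or' \<longleftrightarrow>
     entails sat (Os \<union> Or) \<alpha> \<and>
     (\<exists>H g. minimal_hitting_set {J. justification sat Os Or \<alpha> J} H \<and>
        (\<forall>\<beta>\<in>H. weaker sat (g \<beta>) \<beta> \<and>
           (\<forall>J. justification sat Os Or \<alpha> J \<and> \<beta> \<in> J \<longrightarrow>
              \<not> entails sat (Os \<union> (J - {\<beta>}) \<union> {g \<beta>}) \<alpha>)) \<and>
        Or' = (Or - H) \<union> g ` H)"

text \<open>
  A run from \<open>Or\<close>: \<open>R i\<close> is the refutable part after \<open>i\<close> iterations and \<open>L\<close> is the number of
  iterations, \<open>L = \<infinity>\<close> for a run that never stops. Runs are complete: a finite one ends only where
  no further iteration is possible, either because the loop guard fails or because there is no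
  admissible choice of \<open>H\<close> and \<open>g\<close>. In the second case \<open>R L\<close> still entails \<open>\<alpha>\<close> together with \<open>Os\<close>,
  so it is not a repair; claiming that every run ends in a repair thus includes the claim that the
  required weaker axioms can always be found.
\<close>

definition gentle_run ::
  "('i \<Rightarrow> 'a \<Rightarrow> bool) \<Rightarrow> 'a set \<Rightarrow> 'a set \<Rightarrow> 'a \<Rightarrow> (nat \<Rightarrow> 'a set) \<Rightarrow> enat \<Rightarrow> bool" where
  "gentle_run sat Os Or \<alpha> R L \<longleftrightarrow>
     R 0 = Or \<and>
     (\<forall>i. enat i < L \<longrightarrow> gentle_step sat Os \<alpha> (R i) (R (Suc i))) \<and>
     (\<forall>m. L = enat m \<longrightarrow> \<not> (\<exists>Or'. gentle_step sat Os \<alpha> (R m) Or'))"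

end

theory Submission imports Defs begin

text \<open>
  Trace every axiom of the current refutable part back to the original axioms it descends from, and
  consider the sets \<open>S\<close> of original axioms whose current descendants still entail \<open>\<alpha>\<close> together with
  the static part. Axioms only get weaker, so this family never grows. In each iteration it loses
  the preimage of any justification \<open>J\<close>: the hitting set contains some \<open>\<beta> \<in> J\<close>, and the
  descendants of that preimage then follow from \<open>(J - {\<beta>}) \<union> {\<gamma>\<^sub>\<beta>}\<close>. Hence there are at most
  \<open>2\<^sup>n\<close> iterations. The loop cannot get stuck while \<open>\<alpha>\<close> is entailed, because replacing every
  axiom of a hitting set by a tautology is always an admissible choice.
\<close>

text \<open>The hypothesis compares \<open>A\<close> and \<open>B\<close> through models rather than
  by inclusion, so that the rule covers replacing axioms by weaker ones as well as dropping
  tautologies.\<close>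

lemma entails_mono:
  assumes "entails sat A \<alpha>" and "\<And>I \<beta>. is_model sat I B \<Longrightarrow> \<beta> \<in> A \<Longrightarrow> sat I \<beta>"
  shows "entails sat B \<alpha>"
  using assms unfolding entails_def is_model_def by blast

lemma weaker_sat:
  assumes "weaker sat \<gamma> \<beta>" and "sat I \<beta>"
  shows "sat I \<gamma>"
proof -
  have "\<gamma> \<in> Con sat {\<gamma>}"
    by (simp add: Con_def entails_def is_model_def)
  then have "\<gamma> \<in> Con sat {\<beta>}"
    using assms(1) unfolding weaker_def by blast
  then show ?thesis
    using assms(2) by (simp add: Con_def entails_def is_model_def)
qed

lemma weaker_tautology:
  assumes "tautology sat \<tau>" and "\<not> tautology sat \<beta>"
  shows "weaker sat \<tau> \<beta>"
proof -
  have "Con sat {\<tau>} \<subseteq> Con sat {\<beta>}" "\<beta> \<in> Con sat {\<beta>}" "\<beta> \<notin> Con sat {\<tau>}"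
    using assms by (auto simp: Con_def entails_def is_model_def tautology_def)
  then show ?thesis
    unfolding weaker_def by blast
qed

lemma ex_minimal_subset:
  assumes "finite V" and "P V"
  shows "\<exists>M\<subseteq>V. P M \<and> (\<forall>M'. M' \<subset> M \<longrightarrow> \<not> P M')"
  using assms
proof (induction V rule: finite_psubset_induct)
  case (psubset V)
  show ?case
  proof (cases "\<exists>W\<subset>V. P W")
    case True
    then obtain W where "W \<subset> V" "P W"
      by blast
    with psubset.IH[of W] show ?thesis
      by (meson psubset_imp_subset subset_trans)
  next
    case False
    then show ?thesis
      using psubset.prems by blast
  qed
qed

lemma ex_justification:
  assumes "finite Or" and "entails sat (Os \<union> Or) \<alpha>"
  shows "\<exists>J. justification sat Os Or \<alpha> J"
  using ex_minimal_subset[where P = "\<lambda>J. entails sat (Os \<union> J) \<alpha>", OF assms]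
  unfolding justification_def .

lemma ex_minimal_hitting_set:
  assumes "finite V" and "hitting_set \<J> V"
  shows "\<exists>H. minimal_hitting_set \<J> H"
  using ex_minimal_subset[where P = "hitting_set \<J>", OF assms]
  unfolding minimal_hitting_set_def by blast

lemma minimal_hitting_set_subset_Union:
  assumes "minimal_hitting_set \<J> H"
  shows "H \<subseteq> \<Union>\<J>"
proof -
  have hit: "hitting_set \<J> H" and min: "\<And>H'. H' \<subset> H \<Longrightarrow> \<not> hitting_set \<J> H'"
    using assms by (simp_all add: minimal_hitting_set_def)
  from hit have "hitting_set \<J> (H \<inter> \<Union>\<J>)"
    unfolding hitting_set_def by blast
  with min[of "H \<inter> \<Union>\<J>"] show ?thesis
    by blast
qed

text \<open>Tautologies do not affect entailment, so both conditions on the replacement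
  \<open>\<tau>\<close> reduce to the minimality of justifications: a tautological
  \<open>\<beta>\<close> could be removed from its justification, and putting \<open>\<tau>\<close>
  in place of \<open>\<beta>\<close> amounts to removing \<open>\<beta>\<close>.\<close>

lemma ex_gentle_step:
  assumes \<tau>: "tautology sat \<tau>" and fin: "finite Or"
    and ent: "entails sat (Os \<union> Or) \<alpha>" and nent: "\<not> entails sat Os \<alpha>"
  shows "\<exists>Or'. gentle_step sat Os \<alpha> Or Or'"
proof -
  let ?\<J> = "{J. justification sat Os Or \<alpha> J}"
  \<comment> \<open>A justification is a subset of \<open>Or\<close>, and it is nonempty because
    \<open>Os\<close> alone does not entail \<open>\<alpha>\<close>.\<close>
  have "hitting_set ?\<J> Or"
    using nent unfolding hitting_set_def justification_def by (auto simp: Int_absorb1)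
  from ex_minimal_hitting_set[OF fin this]
  obtain H where H: "minimal_hitting_set ?\<J> H" ..
  have not_entailed: "\<not> entails sat (Os \<union> (J - {\<beta>})) \<alpha>"
    if "justification sat Os Or \<alpha> J" "\<beta> \<in> J" for J \<beta>
    using that unfolding justification_def by blast
  have "weaker sat \<tau> \<beta>" if \<beta>: "\<beta> \<in> H" for \<beta>
  proof (rule weaker_tautology[OF \<tau>], rule notI)
    assume taut: "tautology sat \<beta>"
    obtain J where J: "justification sat Os Or \<alpha> J" "\<beta> \<in> J"
      using minimal_hitting_set_subset_Union[OF H] \<beta> by blast
    then have "entails sat (Os \<union> J) \<alpha>"
      by (simp add: justification_def)
    then have "entails sat (Os \<union> (J - {\<beta>})) \<alpha>"
      by (rule entails_mono)
        (use taut in \<open>auto simp: tautology_def entails_def is_model_def\<close>)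
    then show False
      using not_entailed J by blast
  qed
  moreover have "\<not> entails sat (Os \<union> (J - {\<beta>}) \<union> {\<tau>}) \<alpha>"
    if J: "justification sat Os Or \<alpha> J" "\<beta> \<in> J" for J \<beta>
  proof
    assume "entails sat (Os \<union> (J - {\<beta>}) \<union> {\<tau>}) \<alpha>"
    then have "entails sat (Os \<union> (J - {\<beta>})) \<alpha>"
      by (rule entails_mono)
        (use \<tau> in \<open>auto simp: tautology_def entails_def is_model_def\<close>)
    then show False
      using not_entailed J by blast
  qed
  ultimately have "gentle_step sat Os \<alpha> Or ((Or - H) \<union> (\<lambda>_. \<tau>) ` H)"
    unfolding gentle_step_def using ent H by (intro conjI exI[of _ H] exI[of _ "\<lambda>_. \<tau>"]) auto
  then show ?thesis ..
qed

text \<open>The function \<open>f\<close> sends an original axiom to its current descendant.\<close>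

definition entailing_sets ::
  "('i \<Rightarrow> 'a \<Rightarrow> bool) \<Rightarrow> 'a set \<Rightarrow> 'a set \<Rightarrow> 'a \<Rightarrow> ('a \<Rightarrow> 'a) \<Rightarrow> 'a set set" where
  "entailing_sets sat Os Or \<alpha> f = {S. S \<subseteq> Or \<and> entails sat (Os \<union> f ` S) \<alpha>}"

text \<open>\<open>f\<close> may fail to be injective, since different axioms can receive the same
  replacement. Measuring progress by sets of original axioms keeps the families before and after the
  step comparable inside the fixed power set of \<open>Or\<close>.\<close>

lemma gentle_step_descendants:
  assumes fin: "finite Or" and step: "gentle_step sat Os \<alpha> (f ` Or) R'"
  shows "\<exists>f'. R' = f' ` Or \<and> (\<forall>x I. sat I (f x) \<longrightarrow> sat I (f' x)) \<and>
    entailing_sets sat Os Or \<alpha> f' \<subset> entailing_sets sat Os Or \<alpha> f"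
proof -
  obtain H g where H: "minimal_hitting_set {J. justification sat Os (f ` Or) \<alpha> J} H"
    and weak: "\<forall>\<beta>\<in>H. weaker sat (g \<beta>) \<beta>"
    and break_J: "\<And>\<beta> J. \<beta> \<in> H \<Longrightarrow> justification sat Os (f ` Or) \<alpha> J \<Longrightarrow> \<beta> \<in> J \<Longrightarrow>
      \<not> entails sat (Os \<union> (J - {\<beta>}) \<union> {g \<beta>}) \<alpha>"
    and R': "R' = (f ` Or - H) \<union> g ` H"
    and ent: "entails sat (Os \<union> f ` Or) \<alpha>"
    using step unfolding gentle_step_def by blast
  define f' where "f' x = (if f x \<in> H then g (f x) else f x)" for x
  \<comment> \<open>This ensures that every new axiom \<open>g \<beta>\<close> descends from some
    original axiom.\<close>
  have "H \<subseteq> f ` Or"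
    using minimal_hitting_set_subset_Union[OF H] unfolding justification_def by blast
  then have img: "R' = f' ` Or"
    unfolding R' f'_def by (auto simp: image_iff subset_iff)
  have sat: "sat I (f' x)" if "sat I (f x)" for I x
    using that weak weaker_sat[of sat] unfolding f'_def by auto
  have sub: "entailing_sets sat Os Or \<alpha> f' \<subseteq> entailing_sets sat Os Or \<alpha> f"
  proof
    fix S assume "S \<in> entailing_sets sat Os Or \<alpha> f'"
    then have S: "S \<subseteq> Or" "entails sat (Os \<union> f' ` S) \<alpha>"
      by (simp_all add: entailing_sets_def)
    from S(2) have "entails sat (Os \<union> f ` S) \<alpha>"
      by (rule entails_mono) (auto simp: is_model_def intro: sat)
    with S(1) show "S \<in> entailing_sets sat Os Or \<alpha> f"
      by (simp add: entailing_sets_def)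
  qed
  obtain J where J: "justification sat Os (f ` Or) \<alpha> J"
    using ex_justification[OF _ ent] fin by blast
  then obtain \<beta> where \<beta>: "\<beta> \<in> H" "\<beta> \<in> J"
    using H unfolding minimal_hitting_set_def hitting_set_def by blast
  define S where "S = {x\<in>Or. f x \<in> J}"
  have fS: "f ` S = J"
    using J unfolding S_def justification_def by blast
  have "S \<in> entailing_sets sat Os Or \<alpha> f"
    using J fS unfolding entailing_sets_def justification_def by (auto simp: S_def)
  moreover have "S \<notin> entailing_sets sat Os Or \<alpha> f'"
  proof
    assume "S \<in> entailing_sets sat Os Or \<alpha> f'"
    then have "entails sat (Os \<union> f' ` S) \<alpha>"
      by (simp add: entailing_sets_def)
    then have "entails sat (Os \<union> (J - {\<beta>}) \<union> {g \<beta>}) \<alpha>"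
    proof (rule entails_mono)
      fix I \<delta>
      assume I: "is_model sat I (Os \<union> (J - {\<beta>}) \<union> {g \<beta>})" and \<delta>: "\<delta> \<in> Os \<union> f' ` S"
      \<comment> \<open>\<open>J\<close> may contain further elements of \<open>H\<close>, which are
        replaced as well. Weakening them is harmless: \<open>I\<close> satisfies all of
        \<open>J - {\<beta>}\<close> and therefore also their replacements.\<close>
      have "sat I (f' x)" if "x \<in> S" for x
      proof (cases "f x = \<beta>")
        case True
        then show ?thesis
          using I \<beta> by (simp add: f'_def is_model_def)
      next
        case False
        then show ?thesis
          using I that by (intro sat) (simp add: S_def is_model_def)
      qed
      then show "sat I \<delta>"
        using \<delta> I by (auto simp: is_model_def)
    qed
    then show False
      using break_J \<beta> J by blast
  qed
  ultimately have "entailing_sets sat Os Or \<alpha> f' \<subset> entailing_sets sat Os Or \<alpha> f"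
    using sub by blast
  then show ?thesis
    using img sat by blast
qed

text \<open>Each iteration removes at least one member from a family that starts with at most
  \<open>2 ^ card Or\<close> members, so the sum of \<open>i\<close> and the family's size never
  exceeds this number.\<close>

lemma gentle_steps_descendants:
  assumes fin: "finite Or" and start: "R 0 = Or"
    and steps: "\<forall>j<i. gentle_step sat Os \<alpha> (R j) (R (Suc j))"
  shows "\<exists>f. R i = f ` Or \<and> (\<forall>x I. sat I x \<longrightarrow> sat I (f x)) \<and>
    i + card (entailing_sets sat Os Or \<alpha> f) \<le> 2 ^ card Or"
  using steps
proof (induction i)
  case 0
  have "R 0 = (\<lambda>x. x) ` Or"
    by (simp add: start)
  moreover have "card (entailing_sets sat Os Or \<alpha> (\<lambda>x. x)) \<le> card (Pow Or)"
    by (rule card_mono) (use fin in \<open>auto simp: entailing_sets_def\<close>)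
  ultimately show ?case
    using fin by (intro exI[of _ "\<lambda>x. x"]) (simp add: card_Pow)
next
  case (Suc i)
  have "\<forall>j<i. gentle_step sat Os \<alpha> (R j) (R (Suc j))"
    using Suc.prems less_SucI by blast
  from Suc.IH[OF this]
  obtain f where f: "R i = f ` Or" "\<forall>x I. sat I x \<longrightarrow> sat I (f x)"
    "i + card (entailing_sets sat Os Or \<alpha> f) \<le> 2 ^ card Or"
    by (elim exE conjE) (rule that)
  have "gentle_step sat Os \<alpha> (R i) (R (Suc i))"
    using Suc.prems lessI by blast
  from gentle_step_descendants[OF fin this[unfolded f(1)]]
  obtain f' where f': "R (Suc i) = f' ` Or" "\<forall>x I. sat I (f x) \<longrightarrow> sat I (f' x)"
    "entailing_sets sat Os Or \<alpha> f' \<subset> entailing_sets sat Os Or \<alpha> f"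
    by (elim exE conjE) (rule that)
  have "finite (entailing_sets sat Os Or \<alpha> f)"
    using fin by (simp add: entailing_sets_def)
  then have "card (entailing_sets sat Os Or \<alpha> f') < card (entailing_sets sat Os Or \<alpha> f)"
    using f'(3) by (rule psubset_card_mono)
  then show ?case
    using f(2,3) f'(1,2) by (intro exI[of _ f'] conjI) simp_all
qed

theorem theorem4:
  fixes sat :: "'i \<Rightarrow> 'a \<Rightarrow> bool"
  assumes "\<exists>\<tau>. tautology sat \<tau>"
  shows "\<exists>c::nat. \<forall>Os Or \<alpha> R L.
    finite Os \<and> finite Or \<and> entails sat (Os \<union> Or) \<alpha> \<and> \<not> entails sat Os \<alpha> \<and>
    gentle_run sat Os Or \<alpha> R L \<longrightarrow>
      (\<exists>m. L = enat m \<and> m \<le> 2 ^ (c * card Or) \<and> \<not> entails sat (Os \<union> R m) \<alpha> \<and>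
           repair sat Os Or \<alpha> (R m))"
proof (rule exI[of _ 1], intro allI impI, elim conjE)
  fix Os Or \<alpha> R L
  assume fin: "finite Or" and nent: "\<not> entails sat Os \<alpha>" and run: "gentle_run sat Os Or \<alpha> R L"
  have start: "R 0 = Or"
    and steps: "\<And>i. enat i < L \<Longrightarrow> gentle_step sat Os \<alpha> (R i) (R (Suc i))"
    and maximal: "\<And>m Or'. L = enat m \<Longrightarrow> \<not> gentle_step sat Os \<alpha> (R m) Or'"
    using run unfolding gentle_run_def by blast+
  \<comment> \<open>The case \<open>enat i = L\<close> is included, since reaching
    \<open>R i\<close> only uses the steps with index below \<open>i\<close>; this covers the output
    of a finite run.\<close>
  have descendants: "\<exists>f. R i = f ` Or \<and> (\<forall>x I. sat I x \<longrightarrow> sat I (f x)) \<and>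
      i + card (entailing_sets sat Os Or \<alpha> f) \<le> 2 ^ card Or" if "enat i \<le> L" for i
  proof (rule gentle_steps_descendants[where R = R, OF fin start], intro allI impI)
    fix j assume "j < i"
    then show "gentle_step sat Os \<alpha> (R j) (R (Suc j))"
      using that by (intro steps) (meson enat_ord_simps(2) less_le_trans)
  qed
  have bound: "i \<le> 2 ^ card Or" if "enat i \<le> L" for i
    using descendants[OF that] by (elim exE conjE) linarith
  obtain m where m: "L = enat m"
  proof (cases L)
    case (enat m)
    then show ?thesis
      by (rule that)
  next
    \<comment> \<open>An infinite run would satisfy the bound at every index, which fails at
      \<open>Suc (2 ^ card Or)\<close>.\<close>
    case infinity
    then show ?thesis
      using bound[of "Suc (2 ^ card Or)"] by simp
  qed
  have "enat m \<le> L"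
    by (simp add: m)
  from descendants[OF this]
  obtain f where f: "R m = f ` Or" "\<forall>x I. sat I x \<longrightarrow> sat I (f x)"
    by (elim exE conjE) (rule that)
  have finR: "finite (R m)"
    using f(1) fin by simp
  obtain \<tau> where \<tau>: "tautology sat \<tau>"
    using assms ..
  \<comment> \<open>If \<open>\<alpha>\<close> were still entailed, a further step would exist,
    contradicting the completeness of the run.\<close>
  have stop: "\<not> entails sat (Os \<union> R m) \<alpha>"
    using ex_gentle_step[OF \<tau> finR _ nent] maximal[OF m] by blast
  have "Con sat (Os \<union> R m) \<subseteq> Con sat (Os \<union> Or)"
  proof
    fix \<delta> assume "\<delta> \<in> Con sat (Os \<union> R m)"
    then have "entails sat (Os \<union> R m) \<delta>"
      by (simp add: Con_def)
    then have "entails sat (Os \<union> Or) \<delta>"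
      by (rule entails_mono) (use f in \<open>auto simp: is_model_def\<close>)
    then show "\<delta> \<in> Con sat (Os \<union> Or)"
      by (simp add: Con_def)
  qed
  then have "repair sat Os Or \<alpha> (R m)"
    using finR stop by (simp add: repair_def Con_def)
  then show "\<exists>m. L = enat m \<and> m \<le> 2 ^ (1 * card Or) \<and> \<not> entails sat (Os \<union> R m) \<alpha> \<and>
      repair sat Os Or \<alpha> (R m)"
    using m stop bound[of m] by auto
qed

end
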